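(* Let $H$ be a separable complex Hilbert space and let $X \in B(\ell_2(H))$ have operator matrix $X = [X_{ij}]_{i,j\ge 0}$ with $X_{ij}\in B(H)$. For each $n\ge 1$ and $i,j\ge 0$ set $$A^{(n)}(X)_{ij} = \sum_{k=0}^{\min(i,n-1)} X_{i-k,\,j+k} = X_{ij}+X_{i-1,j+1}+\cdots+X_{i-\min(i,n-1),\,j+\min(i,n-1)},$$ and let $A^{(n)}(X)$ be the matrix $[A^{(n)}(X)_{ij}]_{i,j\ge 0}$. If $$\sup_{n\ge 1}\|A^{(n)}(X)\| < +\infty,$$ then the operator-valued Foguel operator $$R(S^{*(\infty)},S^{(\infty)};X)=\begin{bmatrix} S^{*(\infty)} & X\\ 0 & S^{(\infty)}\end{bmatrix}\in B(\ell_2(H)\oplus \ell_2(H))$$ is similar to a contraction.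
   Context: $B(K)$ denotes the bounded linear operators on a Hilbert space $K$. $\ell_2(H)$ is the Hilbert space of square-summable sequences $(h_i)_{i\ge 0}$ in $H$, i.e. the direct sum of countably many copies of $H$. Operator matrices are taken with respect to this decomposition: $(Xh)_i=\sum_j X_{ij}h_j$. The norm of a matrix $[A_{ij}]_{i,j\ge 0}$ with entries in $B(H)$ is the norm of the operator it defines on $\ell_2(H)$, taken to be $+\infty$ if it does not define a bounded operator. $S^{(\infty)}$ is the unilateral shift on $\ell_2(H)$, $S^{(\infty)}(h_0,h_1,\dots)=(0,h_0,h_1,\dots)$, and $S^{*(\infty)}$ is its adjoint, $S^{*(\infty)}(h_0,h_1,\dots)=(h_1,h_2,\dots)$. An operator $T\in B(K)$ is similar to a contraction if there is an invertible $L\in B(K)$ with $\|L^{-1}TL\|\le 1$. *)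

theory Defs
  imports "HOL-Analysis.Analysis"
begin

section \<open>Complex Hilbert spaces\<close>

class complex_vector = real_vector +
  fixes scaleC :: "complex \<Rightarrow> 'a \<Rightarrow> 'a"  (infixr \<open>*\<^sub>C\<close> 75)
  assumes scaleC_of_real: "complex_of_real r *\<^sub>C x = r *\<^sub>R x"
    and scaleC_add_right: "c *\<^sub>C (x + y) = c *\<^sub>C x + c *\<^sub>C y"
    and scaleC_add_left: "(c + d) *\<^sub>C x = c *\<^sub>C x + d *\<^sub>C x"
    and scaleC_scaleC: "c *\<^sub>C d *\<^sub>C x = (c * d) *\<^sub>C x"

text \<open>
  The complex inner product is conjugate-linear in its first argument. Its real part is the real
  inner product of the underlying real space, so positivity and the relation to the norm are those
  of \<^class>\<open>real_inner\<close>.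
\<close>

class complex_inner = complex_vector + real_inner +
  fixes cinner :: "'a \<Rightarrow> 'a \<Rightarrow> complex"
  assumes cinner_commute: "cinner x y = cnj (cinner y x)"
    and cinner_add_right: "cinner x (y + z) = cinner x y + cinner x z"
    and cinner_scaleC_right: "cinner x (c *\<^sub>C y) = c * cinner x y"
    and Re_cinner: "Re (cinner x y) = inner x y"

class chilbert_space = complex_inner + complete_space

lemma cinner_self: "cinner (x::'a::complex_inner) x = complex_of_real ((norm x)\<^sup>2)"
proof (rule complex_eqI)
  show "Re (cinner x x) = Re (complex_of_real ((norm x)\<^sup>2))"
    by (simp add: Re_cinner power2_norm_eq_inner)
  show "Im (cinner x x) = Im (complex_of_real ((norm x)\<^sup>2))"
    using arg_cong[OF cinner_commute[of x x], of Im] by simp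
qed

lemma norm_scaleC: "norm (c *\<^sub>C x) = cmod c * norm (x::'a::complex_inner)"
proof -
  have "complex_of_real ((norm (c *\<^sub>C x))\<^sup>2) = cinner (c *\<^sub>C x) (c *\<^sub>C x)"
    by (simp add: cinner_self)
  also have "\<dots> = c * cnj (cinner x (c *\<^sub>C x))"
    by (subst cinner_scaleC_right, subst cinner_commute, rule refl)
  also have "\<dots> = c * cnj c * complex_of_real ((norm x)\<^sup>2)"
    by (simp add: cinner_scaleC_right cinner_self)
  also have "\<dots> = complex_of_real ((cmod c * norm x)\<^sup>2)"
    by (simp add: complex_norm_square[symmetric] power_mult_distrib)
  finally have "(norm (c *\<^sub>C x))\<^sup>2 = (cmod c * norm x)\<^sup>2"
    using of_real_eq_iff by blast
  then show ?thesis
    by (simp add: power2_eq_iff_nonneg)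
qed

lemma Im_cinner: "Im (cinner (x::'a::complex_inner) y) = - inner x (\<i> *\<^sub>C y)"
  using Re_cinner[of x "\<i> *\<^sub>C y"] by (simp add: cinner_scaleC_right)

instantiation complex :: chilbert_space
begin
definition "scaleC_complex c (x::complex) = c * x"
definition "cinner_complex (x::complex) y = cnj x * y"
instance
  by standard
    (auto simp: scaleC_complex_def cinner_complex_def algebra_simps inner_complex_def
      scaleR_conv_of_real)
end

text \<open>
  The product carries the norm \<open>sqrt ((norm x)\<^sup>2 + (norm y)\<^sup>2)\<close> from the library, so the product
  type is the Hilbert space direct sum.
\<close>

instantiation prod :: (complex_vector, complex_vector) complex_vector
begin
definition "scaleC_prod c x = (c *\<^sub>C fst x, c *\<^sub>C snd x)"
instance
  by standard
    (simp_all add: scaleC_prod_def scaleC_of_real scaleC_add_right scaleC_add_left scaleC_scaleC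
      prod_eq_iff)
end

instantiation prod :: (complex_inner, complex_inner) complex_inner
begin
definition "cinner_prod x y = cinner (fst x) (fst y) + cinner (snd x) (snd y)"
instance
proof
  fix x y z :: "'a \<times> 'b" and c :: complex
  show "cinner x y = cnj (cinner y x)"
    by (simp add: cinner_prod_def flip: cinner_commute)
  show "cinner x (y + z) = cinner x y + cinner x z"
    by (simp add: cinner_prod_def cinner_add_right)
  show "cinner x (c *\<^sub>C y) = c * cinner x y"
    by (simp add: cinner_prod_def cinner_scaleC_right scaleC_prod_def algebra_simps)
  show "Re (cinner x y) = inner x y"
    by (simp add: cinner_prod_def Re_cinner inner_prod_def)
qed
end

instance prod :: (chilbert_space, chilbert_space) chilbert_space ..


section \<open>Bounded operators\<close>

definition bounded_clinear :: "('a::complex_inner \<Rightarrow> 'b::complex_inner) \<Rightarrow> bool"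
  where "bounded_clinear f \<longleftrightarrow> bounded_linear f \<and> (\<forall>c x. f (c *\<^sub>C x) = c *\<^sub>C f x)"

definition similar_to_contraction :: "('k::chilbert_space \<Rightarrow> 'k) \<Rightarrow> bool"
  where "similar_to_contraction T \<longleftrightarrow> bounded_clinear T \<and>
    (\<exists>(L::'k \<Rightarrow> 'k) L'. bounded_clinear L \<and> bounded_clinear L' \<and> L \<circ> L' = id \<and> L' \<circ> L = id \<and>
      onorm (L' \<circ> T \<circ> L) \<le> 1)"


section \<open>The space of square-summable sequences\<close>

typedef (overloaded) ('a::real_normed_vector) ell2 =
  "{f :: nat \<Rightarrow> 'a. summable (\<lambda>i. (norm (f i))\<^sup>2)}"
  morphisms coord Abs_ell2
  by (rule exI[of _ "\<lambda>_. 0"]) simp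

setup_lifting type_definition_ell2

lemma summable_coord: "summable (\<lambda>i. (norm (coord x i))\<^sup>2)"
  using coord[of x] by simp

lemma coord_Abs: "summable (\<lambda>i. (norm (f i))\<^sup>2) \<Longrightarrow> coord (Abs_ell2 f) = f"
  by (simp add: Abs_ell2_inverse)

lemma ell2_eqI: "(\<And>i. coord x i = coord y i) \<Longrightarrow> x = y"
  by (metis coord_inject ext)

lemma summable_norm2_add:
  fixes f g :: "nat \<Rightarrow> 'a::real_normed_vector"
  assumes "summable (\<lambda>i. (norm (f i))\<^sup>2)" "summable (\<lambda>i. (norm (g i))\<^sup>2)"
  shows "summable (\<lambda>i. (norm (f i + g i))\<^sup>2)"
proof (rule summable_comparison_test')
  show "summable (\<lambda>i. 2 * (norm (f i))\<^sup>2 + 2 * (norm (g i))\<^sup>2)"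
    by (intro summable_add summable_mult assms)
  fix i
  have "(norm (f i + g i))\<^sup>2 \<le> (norm (f i) + norm (g i))\<^sup>2"
    by (intro power_mono norm_triangle_ineq) auto
  also have "\<dots> \<le> 2 * (norm (f i))\<^sup>2 + 2 * (norm (g i))\<^sup>2"
    using sum_squares_bound[of "norm (f i)" "norm (g i)"] by (simp add: power2_sum)
  finally show "norm ((norm (f i + g i))\<^sup>2) \<le> 2 * (norm (f i))\<^sup>2 + 2 * (norm (g i))\<^sup>2"
    by simp
qed

instantiation ell2 :: (real_normed_vector) real_vector
begin

lift_definition zero_ell2 :: "'a ell2" is "\<lambda>_. 0" by simp

lift_definition plus_ell2 :: "'a ell2 \<Rightarrow> 'a ell2 \<Rightarrow> 'a ell2" is "\<lambda>f g i. f i + g i"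
  by (rule summable_norm2_add)

lift_definition uminus_ell2 :: "'a ell2 \<Rightarrow> 'a ell2" is "\<lambda>f i. - f i" by simp

lift_definition minus_ell2 :: "'a ell2 \<Rightarrow> 'a ell2 \<Rightarrow> 'a ell2" is "\<lambda>f g i. f i - g i"
proof -
  fix f g :: "nat \<Rightarrow> 'a"
  assume "summable (\<lambda>i. (norm (f i))\<^sup>2)" "summable (\<lambda>i. (norm (g i))\<^sup>2)"
  then show "summable (\<lambda>i. (norm (f i - g i))\<^sup>2)"
    using summable_norm2_add[of f "\<lambda>i. - g i"] by simp
qed

lift_definition scaleR_ell2 :: "real \<Rightarrow> 'a ell2 \<Rightarrow> 'a ell2" is "\<lambda>r f i. r *\<^sub>R f i"
  by (simp add: power_mult_distrib summable_mult)

instance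
  by standard (transfer; simp add: algebra_simps fun_eq_iff)+

end

lemma coord_simps [simp]:
  "coord 0 i = 0" "coord (x + y) i = coord x i + coord y i"
  "coord (- x) i = - coord x i" "coord (x - y) i = coord x i - coord y i"
  "coord (r *\<^sub>R x) i = r *\<^sub>R coord x i"
  by (transfer, simp)+

lemma summable_inner_coord:
  fixes x y :: "'a::real_inner ell2"
  shows "summable (\<lambda>i. inner (coord x i) (coord y i))"
proof (rule summable_comparison_test')
  show "summable (\<lambda>i. (norm (coord x i))\<^sup>2 + (norm (coord y i))\<^sup>2)"
    by (intro summable_add summable_coord)
  fix i
  have "norm (inner (coord x i) (coord y i)) \<le> norm (coord x i) * norm (coord y i)"
    by (simp add: Cauchy_Schwarz_ineq2)
  also have "\<dots> \<le> (norm (coord x i))\<^sup>2 + (norm (coord y i))\<^sup>2"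
    using sum_squares_bound[of "norm (coord x i)" "norm (coord y i)"]
      mult_nonneg_nonneg[OF norm_ge_zero[of "coord x i"] norm_ge_zero[of "coord y i"]]
    by linarith
  finally show "norm (inner (coord x i) (coord y i)) \<le> (norm (coord x i))\<^sup>2 + (norm (coord y i))\<^sup>2" .
qed

instantiation ell2 :: (real_inner) real_inner
begin

definition inner_ell2 :: "'a ell2 \<Rightarrow> 'a ell2 \<Rightarrow> real"
  where "inner_ell2 x y = (\<Sum>i. inner (coord x i) (coord y i))"
definition norm_ell2 :: "'a ell2 \<Rightarrow> real"
  where "norm_ell2 x = sqrt (inner x x)"
definition dist_ell2 :: "'a ell2 \<Rightarrow> 'a ell2 \<Rightarrow> real"
  where "dist_ell2 x y = norm (x - y)"
definition sgn_ell2 :: "'a ell2 \<Rightarrow> 'a ell2"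
  where "sgn_ell2 x = x /\<^sub>R norm x"
definition uniformity_ell2 :: "('a ell2 \<times> 'a ell2) filter"
  where "uniformity_ell2 = (INF e\<in>{0 <..}. principal {(x, y). dist x y < e})"
definition open_ell2 :: "'a ell2 set \<Rightarrow> bool"
  where "open_ell2 U \<longleftrightarrow> (\<forall>x\<in>U. eventually (\<lambda>(x', y). x' = x \<longrightarrow> y \<in> U) uniformity)"

instance
proof
  fix x y z :: "'a ell2" and r :: real and U :: "'a ell2 set"
  show "dist x y = norm (x - y)" by (simp add: dist_ell2_def)
  show "sgn x = x /\<^sub>R norm x" by (simp add: sgn_ell2_def)
  show "uniformity = (INF e\<in>{0 <..}. principal {(x, y :: 'a ell2). dist x y < e})"
    by (simp add: uniformity_ell2_def)
  show "open U \<longleftrightarrow> (\<forall>x\<in>U. eventually (\<lambda>(x', y). x' = x \<longrightarrow> y \<in> U) uniformity)"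
    by (simp add: open_ell2_def)
  show "norm x = sqrt (inner x x)" by (simp add: norm_ell2_def)
  show "inner x y = inner y x" by (simp add: inner_ell2_def inner_commute)
  show "inner (x + y) z = inner x z + inner y z"
    by (simp add: inner_ell2_def inner_add_left suminf_add summable_inner_coord)
  show "inner (r *\<^sub>R x) y = r * inner x y"
    by (simp add: inner_ell2_def suminf_mult summable_inner_coord)
  show "0 \<le> inner x x"
    unfolding inner_ell2_def by (intro suminf_nonneg summable_inner_coord) simp
  show "inner x x = 0 \<longleftrightarrow> x = 0"
  proof
    assume "inner x x = 0"
    then have "\<forall>i. inner (coord x i) (coord x i) = 0"
      unfolding inner_ell2_def
      by (subst (asm) suminf_eq_zero_iff) (auto intro: summable_inner_coord)
    then show "x = 0" by (intro ell2_eqI) simp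
  qed (simp add: inner_ell2_def)
qed

end

lemma norm_ell2_sq: "(norm (x::'a::real_inner ell2))\<^sup>2 = (\<Sum>i. (norm (coord x i))\<^sup>2)"
  by (simp add: power2_norm_eq_inner inner_ell2_def)

lemma sum_coord_le: "(\<Sum>i<n. (norm (coord x i))\<^sup>2) \<le> (norm (x::'a::real_inner ell2))\<^sup>2"
  unfolding norm_ell2_sq by (intro sum_le_suminf summable_coord) auto

lemma norm_coord_le: "norm (coord x i) \<le> norm (x::'a::real_inner ell2)"
proof -
  have "(norm (coord x i))\<^sup>2 \<le> (\<Sum>j<Suc i. (norm (coord x j))\<^sup>2)"
    by (intro member_le_sum) auto
  also have "\<dots> \<le> (norm x)\<^sup>2" by (rule sum_coord_le)
  finally show ?thesis by (simp add: power2_le_iff_abs_le)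
qed

instance ell2 :: ("{real_inner, complete_space}") complete_space
proof
  fix X :: "nat \<Rightarrow> 'a ell2"
  assume "Cauchy X"
  have "Cauchy (\<lambda>n. coord (X n) i)" for i
  proof (rule metric_CauchyI)
    fix e :: real assume "e > 0"
    then obtain M where M: "dist (X m) (X n) < e" if "m \<ge> M" "n \<ge> M" for m n
      using metric_CauchyD[OF \<open>Cauchy X\<close>] by blast
    have "dist (coord (X m) i) (coord (X n) i) \<le> dist (X m) (X n)" for m n
      using norm_coord_le[of "X m - X n" i] by (simp add: dist_norm)
    then show "\<exists>M. \<forall>m\<ge>M. \<forall>n\<ge>M. dist (coord (X m) i) (coord (X n) i) < e"
      using M by (meson le_less_trans)
  qed
  then have "\<forall>i. \<exists>l. (\<lambda>n. coord (X n) i) \<longlonglongrightarrow> l"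
    by (simp add: Cauchy_convergent_iff convergent_def)
  then obtain g where g: "\<And>i. (\<lambda>n. coord (X n) i) \<longlonglongrightarrow> g i"
    by metis
  have bd: "\<exists>N. \<forall>m\<ge>N. \<forall>K. (\<Sum>i<K. (norm (coord (X m) i - g i))\<^sup>2) \<le> e\<^sup>2" if "e > 0" for e
  proof -
    obtain N where N: "dist (X m) (X n) < e" if "m \<ge> N" "n \<ge> N" for m n
      using metric_CauchyD[OF \<open>Cauchy X\<close> \<open>e > 0\<close>] by blast
    have "(\<Sum>i<K. (norm (coord (X m) i - g i))\<^sup>2) \<le> e\<^sup>2" if "m \<ge> N" for m K
    proof (rule tendsto_upperbound)
      show "(\<lambda>n. \<Sum>i<K. (norm (coord (X m) i - coord (X n) i))\<^sup>2)
          \<longlonglongrightarrow> (\<Sum>i<K. (norm (coord (X m) i - g i))\<^sup>2)"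
        by (intro tendsto_intros g)
      show "\<forall>\<^sub>F n in sequentially. (\<Sum>i<K. (norm (coord (X m) i - coord (X n) i))\<^sup>2) \<le> e\<^sup>2"
        using eventually_ge_at_top[of N]
      proof eventually_elim
        case (elim n)
        have "(\<Sum>i<K. (norm (coord (X m) i - coord (X n) i))\<^sup>2) \<le> (norm (X m - X n))\<^sup>2"
          using sum_coord_le[of "X m - X n" K] by simp
        also have "\<dots> \<le> e\<^sup>2"
          using N[OF \<open>m \<ge> N\<close> elim] by (intro power_mono) (auto simp: dist_norm)
        finally show ?case .
      qed
    qed simp
    then show ?thesis by blast
  qed
  have sm: "summable (\<lambda>i. (norm (coord (X m) i - g i))\<^sup>2)"
    if "\<forall>K. (\<Sum>i<K. (norm (coord (X m) i - g i))\<^sup>2) \<le> e\<^sup>2" for m e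
    using that by (intro summableI_nonneg_bounded) auto
  obtain N1 where "\<forall>m\<ge>N1. \<forall>K. (\<Sum>i<K. (norm (coord (X m) i - g i))\<^sup>2) \<le> 1\<^sup>2"
    using bd[OF zero_less_one] by blast
  then have "summable (\<lambda>i. (norm (coord (X N1) i - g i))\<^sup>2)"
    by (intro sm[where e = 1]) blast
  from summable_norm2_add[OF this summable_coord[of "- X N1"]]
  have sg: "summable (\<lambda>i. (norm (g i))\<^sup>2)"
    by (simp add: norm_minus_commute)
  have "X \<longlonglongrightarrow> Abs_ell2 g"
  proof (rule metric_LIMSEQ_I)
    fix r :: real assume "r > 0"
    then obtain N where N: "\<And>m K. m \<ge> N \<Longrightarrow> (\<Sum>i<K. (norm (coord (X m) i - g i))\<^sup>2) \<le> (r/2)\<^sup>2"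
      using bd[of "r/2"] by auto
    have "dist (X m) (Abs_ell2 g) < r" if "m \<ge> N" for m
    proof -
      have "(norm (X m - Abs_ell2 g))\<^sup>2 = (\<Sum>i. (norm (coord (X m) i - g i))\<^sup>2)"
        by (simp add: norm_ell2_sq coord_Abs[OF sg])
      also have "\<dots> \<le> (r/2)\<^sup>2"
        using N[OF that] sm[of m "r/2"] by (intro suminf_le_const) auto
      finally have "norm (X m - Abs_ell2 g) \<le> r/2"
        by (rule power2_le_imp_le) (use \<open>r > 0\<close> in simp)
      then show ?thesis using \<open>r > 0\<close> by (simp add: dist_norm)
    qed
    then show "\<exists>N. \<forall>n\<ge>N. dist (X n) (Abs_ell2 g) < r" by blast
  qed
  then show "convergent X" by (auto simp: convergent_def)
qed

instantiation ell2 :: (complex_inner) complex_inner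
begin

lift_definition scaleC_ell2 :: "complex \<Rightarrow> 'a ell2 \<Rightarrow> 'a ell2" is "\<lambda>c f i. c *\<^sub>C f i"
  by (simp add: norm_scaleC power_mult_distrib summable_mult)

definition cinner_ell2 :: "'a ell2 \<Rightarrow> 'a ell2 \<Rightarrow> complex"
  where "cinner_ell2 x y = (\<Sum>i. cinner (coord x i) (coord y i))"

lemma coord_scaleC [simp]: "coord (c *\<^sub>C x) i = c *\<^sub>C coord x i"
  by transfer simp

lemma summable_cinner_coord: "summable (\<lambda>i. cinner (coord x i) (coord y i))"
  for x y :: "'a ell2"
  using summable_inner_coord[of x y] summable_minus[OF summable_inner_coord[of x "\<i> *\<^sub>C y"]]
  by (simp add: summable_complex_iff Re_cinner Im_cinner)

instance
proof
  fix x y z :: "'a ell2" and c d :: complex and r :: real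
  show "complex_of_real r *\<^sub>C x = r *\<^sub>R x" by (rule ell2_eqI) (simp add: scaleC_of_real)
  show "c *\<^sub>C (x + y) = c *\<^sub>C x + c *\<^sub>C y" by (rule ell2_eqI) (simp add: scaleC_add_right)
  show "(c + d) *\<^sub>C x = c *\<^sub>C x + d *\<^sub>C x" by (rule ell2_eqI) (simp add: scaleC_add_left)
  show "c *\<^sub>C d *\<^sub>C x = (c * d) *\<^sub>C x" by (rule ell2_eqI) (simp add: scaleC_scaleC)
  have "(\<lambda>i. cnj (cinner (coord y i) (coord x i))) sums cnj (cinner y x)"
    unfolding cinner_ell2_def sums_cnj by (rule summable_sums[OF summable_cinner_coord])
  then show "cinner x y = cnj (cinner y x)"
    by (simp add: sums_iff cinner_ell2_def flip: cinner_commute)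
  show "cinner x (y + z) = cinner x y + cinner x z"
    by (simp add: cinner_ell2_def cinner_add_right suminf_add summable_cinner_coord)
  show "cinner x (c *\<^sub>C y) = c * cinner x y"
    by (simp add: cinner_ell2_def cinner_scaleC_right suminf_mult summable_cinner_coord)
  show "Re (cinner x y) = inner x y"
    by (simp add: cinner_ell2_def inner_ell2_def Re_suminf summable_cinner_coord Re_cinner)
qed

end

instance ell2 :: (chilbert_space) chilbert_space ..


section \<open>Operator matrices\<close>

definition has_op_matrix ::
    "('h::chilbert_space ell2 \<Rightarrow> 'h ell2) \<Rightarrow> (nat \<Rightarrow> nat \<Rightarrow> 'h \<Rightarrow> 'h) \<Rightarrow> bool"
  where "has_op_matrix X M \<longleftrightarrow>
    (\<forall>i j. bounded_clinear (M i j)) \<and> (\<forall>h i. (\<lambda>j. M i j (coord h j)) sums coord (X h) i)"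

lemma has_op_matrix_unique: "has_op_matrix X M \<Longrightarrow> has_op_matrix Y M \<Longrightarrow> X = Y"
  unfolding has_op_matrix_def by (metis ell2_eqI ext sums_unique2)

definition op_matrix_norm :: "(nat \<Rightarrow> nat \<Rightarrow> 'h::chilbert_space \<Rightarrow> 'h) \<Rightarrow> ennreal"
  where "op_matrix_norm M =
    (if \<exists>T. bounded_clinear T \<and> has_op_matrix T M
     then ennreal (onorm (THE T. has_op_matrix T M)) else \<infinity>)"

lemma op_matrix_norm_eq:
  "bounded_clinear T \<Longrightarrow> has_op_matrix T M \<Longrightarrow> op_matrix_norm M = ennreal (onorm T)"
  by (metis (no_types, lifting) has_op_matrix_unique op_matrix_norm_def the_equality)

definition A_matrix :: "nat \<Rightarrow> (nat \<Rightarrow> nat \<Rightarrow> 'h::chilbert_space \<Rightarrow> 'h) \<Rightarrow> nat \<Rightarrow> nat \<Rightarrow> 'h \<Rightarrow> 'h"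
  where "A_matrix n M i j = (\<lambda>h. \<Sum>k = 0..min i (n - 1). M (i - k) (j + k) h)"


section \<open>Shifts and Foguel operators\<close>

lift_definition shift :: "'h::chilbert_space ell2 \<Rightarrow> 'h ell2"
  is "\<lambda>f i. case i of 0 \<Rightarrow> 0 | Suc m \<Rightarrow> f m"
  by (subst summable_Suc_iff[symmetric]) simp

lift_definition shift_adj :: "'h::chilbert_space ell2 \<Rightarrow> 'h ell2"
  is "\<lambda>f i. f (Suc i)"
  by (subst summable_Suc_iff)

lemma coord_shift: "coord (shift x) i = (case i of 0 \<Rightarrow> 0 | Suc m \<Rightarrow> coord x m)"
  by transfer simp

lemma coord_shift_adj: "coord (shift_adj x) i = coord x (Suc i)"
  by transfer simp

lemma cinner_zero_left: "cinner 0 (x::'a::complex_inner) = 0"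
  by (simp add: complex_eq_iff Re_cinner Im_cinner)

lemma shift_adjoint: "cinner (shift x) y = cinner x (shift_adj y)"
proof -
  have "cinner (shift x) y = (\<Sum>i. cinner (coord (shift x) (Suc i)) (coord y (Suc i)))"
    using suminf_split_initial_segment[OF summable_cinner_coord[of "shift x" y], of 1]
    by (simp add: cinner_ell2_def coord_shift cinner_zero_left)
  then show ?thesis
    by (simp add: cinner_ell2_def coord_shift coord_shift_adj)
qed

text \<open>The operator matrix with rows \<open>(A, X)\<close> and \<open>(0, B)\<close>.\<close>

definition foguel :: "('k \<Rightarrow> 'k) \<Rightarrow> ('k \<Rightarrow> 'k) \<Rightarrow> ('k \<Rightarrow> 'k) \<Rightarrow> 'k \<times> 'k \<Rightarrow> 'k \<times> ('k::chilbert_space)"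
  where "foguel A B X = (\<lambda>(h, k). (A h + X k, B k))"

lemma norm_shift: "norm (shift x) = norm x"
proof -
  have "(norm (shift x))\<^sup>2 = (norm x)\<^sup>2"
    using suminf_split_initial_segment[OF summable_coord[of "shift x"], of 1]
    by (simp add: norm_ell2_sq coord_shift)
  then show ?thesis by (simp add: power2_eq_iff_nonneg)
qed

lemma norm_shift_adj_le: "norm (shift_adj x) \<le> norm x"
proof -
  have "(norm (shift_adj x))\<^sup>2 \<le> (norm x)\<^sup>2"
    using suminf_split_initial_segment[OF summable_coord[of x], of 1]
    by (simp add: norm_ell2_sq coord_shift_adj)
  then show ?thesis by (rule power2_le_imp_le) simp
qed

lemma scaleC_zero_right: "c *\<^sub>C (0::'a::complex_vector) = 0"
  using scaleC_add_right[of c 0 "0::'a"] by simp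

lemma bounded_clinear_shift: "bounded_clinear shift"
  unfolding bounded_clinear_def
proof (intro conjI allI)
  show "bounded_linear shift"
    by (rule bounded_linear_intro[where K = 1])
      (auto intro!: ell2_eqI simp: coord_shift norm_shift split: nat.split)
qed (auto intro!: ell2_eqI simp: coord_shift scaleC_zero_right split: nat.split)

lemma bounded_clinear_shift_adj: "bounded_clinear shift_adj"
  unfolding bounded_clinear_def
proof (intro conjI allI)
  show "bounded_linear shift_adj"
    by (rule bounded_linear_intro[where K = 1])
      (auto intro!: ell2_eqI simp: coord_shift_adj norm_shift_adj_le)
qed (auto intro!: ell2_eqI simp: coord_shift_adj)

lemma bounded_clinear_foguel:
  assumes "bounded_clinear A" "bounded_clinear B" "bounded_clinear X"
  shows "bounded_clinear (foguel A B X)"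
proof -
  have lin: "bounded_linear A" "bounded_linear B" "bounded_linear X"
    using assms by (simp_all add: bounded_clinear_def)
  note fst = bounded_linear_compose[OF _ bounded_linear_fst]
    and snd = bounded_linear_compose[OF _ bounded_linear_snd]
  have "bounded_linear (\<lambda>p. (A (fst p) + X (snd p), B (snd p)))"
    by (rule bounded_linear_Pair[OF bounded_linear_add[OF fst[OF lin(1)] snd[OF lin(3)]]
        snd[OF lin(2)]])
  then show ?thesis
    using assms
    by (simp add: bounded_clinear_def foguel_def case_prod_beta' scaleC_prod_def scaleC_add_right)
qed

end

theory Submission
  imports Defs
begin

text \<open>
  Write \<open>S\<close> for the shift and \<open>A\<^sub>n\<close> for the operator of the \<open>n\<close>-th matrix, so that
  \<open>A\<^sub>n = (\<Sum>k<n. S ^ k X S ^ k)\<close>. Every term with \<open>k > i\<close> has zero \<open>i\<close>-th row, so the \<open>i\<close>-th row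
  of \<open>A\<^sub>n\<close> is the same for all \<open>n > i\<close>. The matrices thus stabilise row by row, and for every \<open>N\<close>
  the first \<open>N\<close> rows of the limit inherit the uniform bound on the norms. Hence the limit is a
  bounded operator \<open>Y\<close> (lemma \<open>rowwise_limit\<close>). The recursion that sends \<open>A\<^sub>n\<close> to
  \<open>X + S A\<^sub>n S\<close>, the next member of the family, becomes \<open>Y = X + S Y S\<close> in the limit.

  Put \<open>Z = S Y\<close>. As \<open>S\<^sup>* S = 1\<close>, this says \<open>S\<^sup>* Z - Z S = Y - S Y S = X\<close>. A bounded solution \<open>Z\<close>
  of this operator equation makes the Foguel operator similar, through the upper triangular matrix
  with unit diagonal and corner \<open>- Z\<close>, to the direct sum of \<open>S\<^sup>*\<close> and \<open>S\<close>, which is a contraction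
  (lemma \<open>foguel_similar_to_contraction\<close>).
\<close>

lemma bounded_clinear_compose:
  "bounded_clinear f \<Longrightarrow> bounded_clinear g \<Longrightarrow> bounded_clinear (\<lambda>x. f (g x))"
  by (auto simp: bounded_clinear_def intro: bounded_linear_compose)

lemma bounded_clinear_uminus:
  assumes "bounded_clinear f"
  shows "bounded_clinear (\<lambda>x. - f x)"
proof -
  have "c *\<^sub>C (- y) = - (c *\<^sub>C y)" for c and y :: 'b
    using scaleC_add_right[of c y "- y"]
    by (simp add: scaleC_zero_right eq_neg_iff_add_eq_0 add.commute)
  then show ?thesis
    using assms by (simp add: bounded_clinear_def bounded_linear_minus)
qed

text \<open>
  Conjugation by the unipotent \<open>L\<close> with corner \<open>- Z\<close> adds \<open>Z B - A Z\<close> to the corner of the operator,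
  so the equation for \<open>Z\<close> is exactly what removes \<open>X\<close>.
\<close>

lemma foguel_similar_to_contraction:
  fixes A B X Z :: "'k::chilbert_space \<Rightarrow> 'k"
  assumes A: "bounded_clinear A" "\<And>h. norm (A h) \<le> norm h"
    and B: "bounded_clinear B" "\<And>h. norm (B h) \<le> norm h"
    and X: "bounded_clinear X"
    and Z: "bounded_clinear Z"
    and eq: "\<And>h. A (Z h) - Z (B h) = X h"
  shows "similar_to_contraction (foguel A B X)"
proof -
  define L where "L = foguel id id (\<lambda>h. - Z h)"
  define L' where "L' = foguel id id Z"
  have id: "bounded_clinear (id :: 'k \<Rightarrow> 'k)"
    by (simp add: bounded_clinear_def id_def)
  have L: "bounded_clinear L" and L': "bounded_clinear L'"
    unfolding L_def L'_def
    by (intro bounded_clinear_foguel id Z bounded_clinear_uminus)+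
  have inv: "L \<circ> L' = id" "L' \<circ> L = id"
    by (auto simp: L_def L'_def foguel_def)
  have "A (h - Z k) + X k + Z (B k) = A h" for h k
  proof -
    have "A (h - Z k) = A h - A (Z k)"
      using A(1) by (simp add: bounded_clinear_def bounded_linear.linear linear_diff)
    then show ?thesis
      using eq[of k, symmetric] by simp
  qed
  then have diag: "(L' \<circ> foguel A B X \<circ> L) (h, k) = (A h, B k)" for h k
    by (simp add: L_def L'_def foguel_def)
  have "norm ((L' \<circ> foguel A B X \<circ> L) p) \<le> 1 * norm p" for p
    using A(2)[of "fst p"] B(2)[of "snd p"] diag[of "fst p" "snd p"]
    by (cases p) (simp add: norm_Pair add_mono power_mono)
  then have "onorm (L' \<circ> foguel A B X \<circ> L) \<le> 1"
    by (rule onorm_bound[rotated]) simp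
  then show ?thesis
    unfolding similar_to_contraction_def
    using bounded_clinear_foguel[OF A(1) B(1) X] L L' inv by blast
qed

text \<open>
  The first \<open>N\<close> coordinates of \<open>Y h\<close> are those of \<open>T N h\<close>, so all partial sums of the squared norm of
  \<open>Y h\<close> are at most \<open>(C * norm h)\<^sup>2\<close>.
\<close>

lemma rowwise_limit:
  fixes T :: "nat \<Rightarrow> 'h::chilbert_space ell2 \<Rightarrow> 'h ell2"
  assumes T: "\<And>n. n \<ge> 1 \<Longrightarrow> bounded_clinear (T n)"
    and bound: "\<And>n h. n \<ge> 1 \<Longrightarrow> norm (T n h) \<le> C * norm h"
    and rows: "\<And>n i h. i < n \<Longrightarrow> coord (T n h) i = coord (T (Suc i) h) i"
  obtains Y where "bounded_clinear Y" "\<And>h i. coord (Y h) i = coord (T (Suc i) h) i"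
proof -
  define f where "f h i = coord (T (Suc i) h) i" for h i
  define Y where "Y h = Abs_ell2 (f h)" for h
  have partial: "(\<Sum>i<N. (norm (f h i))\<^sup>2) \<le> (C * norm h)\<^sup>2" for h N
  proof (cases "N = 0")
    case False
    have "(\<Sum>i<N. (norm (f h i))\<^sup>2) = (\<Sum>i<N. (norm (coord (T N h) i))\<^sup>2)"
      by (intro sum.cong) (simp_all add: f_def rows[of _ N])
    also have "\<dots> \<le> (norm (T N h))\<^sup>2"
      by (rule sum_coord_le)
    also have "\<dots> \<le> (C * norm h)\<^sup>2"
      using False by (intro power_mono bound) auto
    finally show ?thesis .
  qed simp
  have summable: "summable (\<lambda>i. (norm (f h i))\<^sup>2)" for h
    using partial by (intro summableI_nonneg_bounded) auto
  have Y: "coord (Y h) i = f h i" for h i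
    by (simp add: Y_def coord_Abs[OF summable])
  have nonneg: "C * norm h \<ge> 0" for h :: "'h ell2"
    using order_trans[OF norm_ge_zero bound[of 1 h]] by simp
  have norm_Y: "norm (Y h) \<le> norm h * C" for h
  proof (rule power2_le_imp_le)
    show "(norm (Y h))\<^sup>2 \<le> (norm h * C)\<^sup>2"
      unfolding norm_ell2_sq Y using summable partial
      by (intro suminf_le_const) (auto simp: mult.commute)
  qed (use nonneg[of h] in \<open>simp add: mult.commute\<close>)
  have lin: "linear (T (Suc i))" for i
    using T[of "Suc i"] by (simp add: bounded_clinear_def bounded_linear.linear)
  have "bounded_linear Y"
    using norm_Y
    by (intro bounded_linear_intro[where K = C] ell2_eqI)
      (auto simp: Y f_def linear_add[OF lin] linear_scale[OF lin])
  moreover have "Y (c *\<^sub>C h) = c *\<^sub>C Y h" for c h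
    using T by (intro ell2_eqI) (simp add: Y f_def bounded_clinear_def)
  ultimately show thesis
    using that[of Y] Y by (simp add: bounded_clinear_def f_def)
qed

text \<open>
  Splitting off \<open>k = 0\<close> and shifting the index of the other terms is the entrywise form of the
  recursion \<open>X + S A\<^sub>n S\<close>, stated for the sizes from which on the two rows are stable.
\<close>

lemma A_matrix_Suc:
  "A_matrix (Suc (Suc i)) M (Suc i) j h = M (Suc i) j h + A_matrix (Suc i) M i (Suc j) h"
  by (simp add: A_matrix_def sum.atLeast0_atMost_Suc_shift del: sum.cl_ivl_Suc)

lemma A_matrix_stable: "i < n \<Longrightarrow> A_matrix n M i = A_matrix (Suc i) M i"
  by (simp add: A_matrix_def min_def fun_eq_iff)

text \<open>
  A finite supremum excludes the value \<open>\<infinity>\<close>, so every matrix of the family is that of a bounded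
  operator, and the supremum is a common bound.
\<close>

lemma uniformly_bounded_operators:
  fixes F :: "nat \<Rightarrow> nat \<Rightarrow> nat \<Rightarrow> 'h::chilbert_space \<Rightarrow> 'h"
  assumes "(SUP n\<in>I. op_matrix_norm (F n)) < \<infinity>"
  obtains T C where "\<And>n. n \<in> I \<Longrightarrow> bounded_clinear (T n)"
    "\<And>n. n \<in> I \<Longrightarrow> has_op_matrix (T n) (F n)"
    "\<And>n h. n \<in> I \<Longrightarrow> norm (T n h) \<le> C * norm h"
proof -
  define s where "s = (SUP n\<in>I. op_matrix_norm (F n))"
  have le: "op_matrix_norm (F n) \<le> s" if "n \<in> I" for n
    using that by (auto simp: s_def intro: SUP_upper)
  have fin: "s < \<infinity>"
    using assms by (simp add: s_def)
  have "\<exists>T. bounded_clinear T \<and> has_op_matrix T (F n)" if "n \<in> I" for n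
    using le[OF that] fin by (auto simp: op_matrix_norm_def split: if_splits)
  then obtain T where
    T: "\<And>n. n \<in> I \<Longrightarrow> bounded_clinear (T n)" "\<And>n. n \<in> I \<Longrightarrow> has_op_matrix (T n) (F n)"
    by metis
  have "norm (T n h) \<le> enn2real s * norm h" if "n \<in> I" for n h
  proof -
    have lin: "bounded_linear (T n)"
      using T(1)[OF that] by (simp add: bounded_clinear_def)
    have "ennreal (onorm (T n)) \<le> s"
      using le[OF that] op_matrix_norm_eq[OF T[OF that]] by simp
    then have "onorm (T n) \<le> enn2real s"
      using fin onorm_pos_le[OF lin] enn2real_mono by fastforce
    then show ?thesis
      using onorm[OF lin, of h] by (meson mult_right_mono norm_ge_zero order_trans)
  qed
  then show thesis
    using that T by blast
qed

theorem theorem2p1: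
  fixes X :: "'h::chilbert_space ell2 \<Rightarrow> 'h ell2"
    and M :: "nat \<Rightarrow> nat \<Rightarrow> 'h \<Rightarrow> 'h"
  assumes "separable_space (euclidean :: 'h topology)"
    and "bounded_clinear X"
    and "has_op_matrix X M"
    and "(SUP n\<in>{1..}. op_matrix_norm (A_matrix n M)) < \<infinity>"
  shows "similar_to_contraction (foguel shift_adj shift X)"
proof -
  obtain T C where
    T: "\<And>n. n \<ge> 1 \<Longrightarrow> bounded_clinear (T n)"
    and bound: "\<And>n h. n \<ge> 1 \<Longrightarrow> norm (T n h) \<le> C * norm h"
    and mat: "\<And>n. n \<ge> 1 \<Longrightarrow> has_op_matrix (T n) (A_matrix n M)"
    using uniformly_bounded_operators[OF assms(4)] unfolding atLeast_iff by metis
  have sums: "(\<lambda>j. A_matrix n M i j (coord h j)) sums coord (T n h) i" if "n \<ge> 1" for n i h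
    using mat[OF that] by (simp add: has_op_matrix_def)
  have X_sums: "(\<lambda>j. M i j (coord h j)) sums coord (X h) i" for i h
    using assms(3) by (simp add: has_op_matrix_def)
  have "coord (T n h) i = coord (T (Suc i) h) i" if "i < n" for n i h
    using sums[of n i h] sums[of "Suc i" i h] that
    by (simp add: A_matrix_stable[OF that] sums_unique2)
  from rowwise_limit[OF T bound this] obtain Y
    where Y: "bounded_clinear Y" and coord_Y: "\<And>h i. coord (Y h) i = coord (T (Suc i) h) i"
    by metis
  have fixpoint: "Y h = X h + shift (Y (shift h))" for h
  proof (rule ell2_eqI)
    fix i
    show "coord (Y h) i = coord (X h + shift (Y (shift h))) i"
    proof (cases i)
      case 0
      have "(\<lambda>j. M 0 j (coord h j)) sums coord (Y h) 0"
        using sums[of 1 0 h] by (simp add: coord_Y A_matrix_def)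
      then show ?thesis
        using X_sums[of 0 h] 0 by (simp add: coord_shift sums_unique2)
    next
      case (Suc m)
      let ?a = "\<lambda>j. A_matrix (Suc m) M m j (coord (shift h) j)"
      have "?a 0 = 0"
        using mat[of "Suc m"]
        by (simp add: has_op_matrix_def bounded_clinear_def coord_shift linear_0 bounded_linear.linear)
      moreover have "?a sums coord (Y (shift h)) m"
        using sums[of "Suc m" m "shift h"] by (simp add: coord_Y)
      ultimately have "(\<lambda>j. ?a (Suc j)) sums coord (Y (shift h)) m"
        using sums_Suc_iff[of ?a "coord (Y (shift h)) m"] by simp
      then have "(\<lambda>j. A_matrix (Suc m) M m (Suc j) (coord h j)) sums coord (Y (shift h)) m"
        by (simp add: coord_shift)
      then have "(\<lambda>j. A_matrix (Suc (Suc m)) M (Suc m) j (coord h j))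
          sums (coord (X h) (Suc m) + coord (Y (shift h)) m)"
        unfolding A_matrix_Suc by (intro sums_add X_sums)
      then show ?thesis
        using sums[of "Suc (Suc m)" "Suc m" h] Suc
        by (simp add: coord_Y coord_shift sums_unique2)
    qed
  qed
  have isometry: "shift_adj (shift y) = y" for y :: "'h ell2"
    by (rule ell2_eqI) (simp add: coord_shift_adj coord_shift)
  show ?thesis
  proof (rule foguel_similar_to_contraction[where Z = "\<lambda>h. shift (Y h)"])
    show "bounded_clinear (\<lambda>h. shift (Y h))"
      by (rule bounded_clinear_compose[OF bounded_clinear_shift Y])
    show "shift_adj (shift (Y h)) - shift (Y (shift h)) = X h" for h
      using fixpoint[of h] by (simp add: isometry)
  qed (simp_all add: bounded_clinear_shift bounded_clinear_shift_adj assms(2) norm_shift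
      norm_shift_adj_le)
qed

end
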